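(* For every $d \in \mathbb{N}$ there is $q_0 = q_0(d) \in \mathbb{N}$ such that no finite projective plane $(P, \mathcal{L})$ of order $q \geq q_0$ is representable by convex sets in $\mathbb{R}^d$.
   Context: A finite projective plane of order $q \geq 2$ is a pair $(P, \mathcal{L})$ where $P$ is a finite set of points and $\mathcal{L}$ is a set of subsets of $P$ (called lines) such that (i) every two points are contained in a unique line, (ii) every two lines intersect in a unique point, and (iii) every line contains $q+1$ points. A set system $(X, \mathcal{F})$ ($X$ finite, $\mathcal{F}$ a set of subsets of $X$) is representable by convex sets in $\mathbb{R}^d$ if there are convex sets $C_F \subseteq \mathbb{R}^d$, $F \in \mathcal{F}$, such that for any $F_1, \dots, F_k \in \mathcal{F}$ the sets $C_{F_1}, \dots, C_{F_k}$ have a common point if and only if $F_1, \dots, F_k$ have a common point in $X$.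
   Formalization: Planes must also have four points, no three collinear, excluding exactly systems with at most one line (e.g. L={P}, which satisfies (i)-(iii) and is representable); points are natural numbers (general up to isomorphism), and d≥1 (d=0 follows from d=1). *)

theory Defs
  imports "HOL-Analysis.Analysis"
begin

text \<open>Finite projective plane of order q on point set P with set of lines L.
  Axioms (i)-(iii) of the paper, plus finiteness and the standard
  non-degeneracy axiom (four points, no three collinear), which excludes
  the degenerate configurations (no line / a single line) that also satisfy (i)-(iii).\<close>
definition projective_plane :: "'a set \<Rightarrow> 'a set set \<Rightarrow> nat \<Rightarrow> bool" where
  "projective_plane P L q \<longleftrightarrow>
     finite P \<and> q \<ge> 2 \<and>
     (\<forall>l\<in>L. l \<subseteq> P) \<and>
     (\<forall>x\<in>P. \<forall>y\<in>P. x \<noteq> y \<longrightarrow> (\<exists>!l. l \<in> L \<and> x \<in> l \<and> y \<in> l)) \<and>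
     (\<forall>l\<in>L. \<forall>m\<in>L. l \<noteq> m \<longrightarrow> (\<exists>!x. x \<in> l \<and> x \<in> m)) \<and>
     (\<forall>l\<in>L. card l = q + 1) \<and>
     (\<exists>S\<subseteq>P. card S = 4 \<and> (\<forall>l\<in>L. card (S \<inter> l) \<le> 2))"

definition convex_representation ::
    "'a set \<Rightarrow> 'a set set \<Rightarrow> ('a set \<Rightarrow> 'b::real_vector set) \<Rightarrow> bool" where
  "convex_representation X F C \<longleftrightarrow>
     (\<forall>A\<in>F. convex (C A)) \<and>
     (\<forall>S. S \<subseteq> F \<and> S \<noteq> {} \<and> finite S \<longrightarrow>
        ((\<Inter>A\<in>S. C A) \<noteq> {} \<longleftrightarrow> (\<exists>x\<in>X. \<forall>A\<in>S. x \<in> A)))"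

definition representable_convex_in ::
    "'a set \<Rightarrow> 'a set set \<Rightarrow> 'b::real_vector itself \<Rightarrow> bool" where
  "representable_convex_in X F (_ :: 'b itself) \<longleftrightarrow>
     (\<exists>C :: 'a set \<Rightarrow> 'b set. convex_representation X F C)"

end

theory Submission
  imports Defs
begin

text \<open>
  Choose, for every point \<open>p\<close> of a represented plane, a point \<open>x p\<close> common to the convex sets of the
  lines through \<open>p\<close>, and let \<open>a\<close> be a centerpoint of these \<open>n = q\<^sup>2 + q + 1\<close> points. If \<open>a\<close> is not in the
  convex hull of a line \<open>l\<close>, then \<open>l\<close> avoids a half-space through \<open>a\<close> that contains at least
  \<open>n / (d + 1)\<close> points. A cutting of the space of directions yields boundedly many sets of
  \<open>\<ge> n / (2 (d + 1))\<close> points such that each such half-space contains one of them. A second moment count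
  shows that only \<open>O(q)\<close> lines avoid a given set of that size, so more than \<open>q + 1\<close> lines have \<open>a\<close> in
  their convex sets, although at most \<open>q + 1\<close> lines are concurrent.
\<close>

section \<open>Cuttings\<close>

text \<open>\<open>sgn\<close> takes three values, so a set that touches the zero set of
  \<open>f\<close> without lying inside it also counts as crossed.\<close>

definition crosses :: "('u \<Rightarrow> real) \<Rightarrow> 'u set \<Rightarrow> bool" where
  "crosses f U \<longleftrightarrow> (\<exists>u\<in>U. \<exists>v\<in>U. sgn (f u) \<noteq> sgn (f v))"

lemma crosses_mono: "crosses f U \<Longrightarrow> U \<subseteq> V \<Longrightarrow> crosses f V"
  unfolding crosses_def by blast

lemma crosses_mult_left: "a \<noteq> 0 \<Longrightarrow> crosses (\<lambda>u. a * f u) U \<longleftrightarrow> crosses f U"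
  unfolding crosses_def by (simp add: sgn_mult sgn_zero_iff)

lemma not_crosses_le:
  assumes "\<not> crosses (\<lambda>u. f u - g u) U" "u \<in> U" "v \<in> U" "f u \<le> g u"
  shows "f v \<le> g v"
proof -
  have "sgn (f u - g u) = sgn (f v - g v)"
    using assms unfolding crosses_def by blast
  then show ?thesis using assms(4) by (auto simp: sgn_if split: if_splits)
qed

text \<open>\<open>Y\<close> collects the maxima of successive blocks of \<open>s\<close> elements,
  each block having the smallest remaining values. A set \<open>W\<close> with at least
  \<open>s\<close> elements is the current block, or meets it and also contains a later element, or
  is disjoint from it and left to the recursion.\<close>

lemma quantile_subset:
  fixes v :: "'i \<Rightarrow> real" and s :: nat
  assumes "finite G" "s > 0"
  shows "\<exists>Y\<subseteq>G. s * card Y \<le> card G \<and>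
    (\<forall>W\<subseteq>G. card W \<ge> s \<longrightarrow> (\<exists>y\<in>Y. \<exists>w\<in>W. \<exists>w'\<in>W. v w \<le> v y \<and> v y \<le> v w'))"
  using assms(1)
proof (induction "card G" arbitrary: G rule: less_induct)
  case less
  show ?case
  proof (cases "card G < s")
    case True
    then have "\<And>W. W \<subseteq> G \<Longrightarrow> card W < s"
      using less.prems by (meson card_mono le_less_trans)
    then show ?thesis by (intro exI[of _ "{}"]) (auto simp: not_le[symmetric])
  next
    case False
    \<comment> \<open>Peels off smallest elements one at a time, with ties broken arbitrarily; the
      block is the case \<open>r = s\<close>.\<close>
    have "\<exists>A\<subseteq>G. card A = r \<and> (\<forall>a\<in>A. \<forall>b\<in>G - A. v a \<le> v b)" if "r \<le> card G" for r
      using that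
    proof (induction r)
      case 0
      then show ?case by (intro exI[of _ "{}"]) auto
    next
      case (Suc r)
      then obtain A where A: "A \<subseteq> G" "card A = r" "\<forall>a\<in>A. \<forall>b\<in>G - A. v a \<le> v b" by auto
      have "A \<noteq> G" using A(2) Suc.prems by auto
      then have ne: "G - A \<noteq> {}" using A(1) by auto
      have "finite (G - A)" using less.prems by auto
      then obtain m where m: "m \<in> G - A" "\<forall>b\<in>G - A. v m \<le> v b"
        using ne by (metis arg_min_if_finite(1) arg_min_least)
      have "card (insert m A) = Suc r" using m A less.prems by (simp add: finite_subset)
      then show ?case using A m by (intro exI[of _ "insert m A"]) auto
    qed
    from this[of s] False obtain A
      where A: "A \<subseteq> G" "card A = s" "\<forall>a\<in>A. \<forall>b\<in>G - A. v a \<le> v b" by auto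
    have fA: "finite A" using A(1) less.prems finite_subset by blast
    have "A \<noteq> {}" using A(2) assms(2) by auto
    then have "Max (v ` A) \<in> v ` A" using fA by (intro Max_in) auto
    then obtain y where y: "y \<in> A" "v y = Max (v ` A)" by auto
    have ymax: "v a \<le> v y" if "a \<in> A" for a using that y fA by simp
    have cd: "card (G - A) = card G - s" using A fA by (simp add: card_Diff_subset)
    then have lt: "card (G - A) < card G" using False assms(2) by linarith
    obtain Y where Y: "Y \<subseteq> G - A" "s * card Y \<le> card (G - A)"
      "\<And>W. W \<subseteq> G - A \<Longrightarrow> card W \<ge> s \<Longrightarrow> \<exists>y\<in>Y. \<exists>w\<in>W. \<exists>w'\<in>W. v w \<le> v y \<and> v y \<le> v w'"
      using less.hyps[OF lt] less.prems by (meson finite_Diff)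
    have fY: "finite Y" using Y(1) less.prems by (meson finite_Diff finite_subset)
    have "card (insert y Y) \<le> Suc (card Y)" by (simp add: card_insert_le_m1 fY card_insert_if)
    then have "s * card (insert y Y) \<le> s * Suc (card Y)" by (rule mult_le_mono2)
    also have "\<dots> \<le> card G" using Y(2) cd False by simp
    finally have c: "s * card (insert y Y) \<le> card G" .
    have "\<exists>y\<in>insert y Y. \<exists>w\<in>W. \<exists>w'\<in>W. v w \<le> v y \<and> v y \<le> v w'"
      if W: "W \<subseteq> G" "card W \<ge> s" for W
    proof (cases "W \<inter> A = {}")
      case True
      then show ?thesis using Y(3)[of W] W by blast
    next
      case False
      then obtain w where w: "w \<in> W" "w \<in> A" by auto
      show ?thesis
      proof (cases "W \<subseteq> A")
        case True
        then have "W = A" using W(2) A(2) fA by (simp add: card_seteq)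
        then show ?thesis using y ymax by blast
      next
        case False
        then obtain w' where "w' \<in> W" "w' \<in> G - A" using W by blast
        then show ?thesis using w ymax A(3) y(1) by blast
      qed
    qed
    then show ?thesis using c Y(1) A(1) y(1) by (intro exI[of _ "insert y Y"]) auto
  qed
qed

text \<open>On most pairs the order of \<open>g x\<close> and \<open>g y\<close> is constant on \<open>U\<close>. Take for \<open>Y\<close> the quantiles, at one
  point of \<open>U\<close>, of those \<open>g x\<close> that belong to few bad pairs. If \<open>t - g x\<close> changes sign where the signs
  of all \<open>t - g y\<close> are fixed, then \<open>x\<close> is in a bad pair with some \<open>y\<close>, or in many bad pairs, or
  between two consecutive quantiles.\<close>
lemma threshold_subdivision:
  fixes g :: "'i \<Rightarrow> 'u \<Rightarrow> real" and t :: "'u \<Rightarrow> real" and \<eta> :: real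
  assumes X: "finite X" and \<eta>: "0 < \<eta>" "\<eta> \<le> 1"
    and few: "real (card {p \<in> X \<times> X. crosses (\<lambda>u. g (fst p) u - g (snd p) u) U})
              \<le> \<eta> ^ 4 * real (card X) ^ 2"
  shows "\<exists>Y\<subseteq>X. real (card Y) \<le> 1 / \<eta> \<and> (\<forall>A B. real (card {x\<in>X. crosses (\<lambda>u. t u - g x u)
    {u\<in>U. A = {y\<in>Y. g y u < t u} \<and> B = {y\<in>Y. t u < g y u}}}) \<le> 3 * \<eta> * real (card X))"
proof (cases "X = {} \<or> U = {}")
  case True
  then show ?thesis using \<eta> by (intro exI[of _ "{}"]) (auto simp: crosses_def)
next
  case False
  then obtain u0 where u0: "u0 \<in> U" by auto
  define n where "n = real (card X)"
  have n: "n > 0" using False X by (auto simp: n_def card_gt_0_iff)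
  define N where "N x = {y\<in>X. crosses (\<lambda>u. g x u - g y u) U}" for x
  have fN: "finite (N x)" for x using X by (simp add: N_def)
  \<comment> \<open>\<open>N x\<close> holds the bad partners of \<open>x\<close>. By Markov's
    inequality, carried out below, at most \<open>\<eta>\<^sup>2 * n\<close> indices fall outside
    \<open>G\<close>.\<close>
  define G where "G = {x\<in>X. real (card (N x)) \<le> \<eta>\<^sup>2 * n}"
  have fG: "finite G" "G \<subseteq> X" using X by (auto simp: G_def)
  have "{p \<in> X \<times> X. crosses (\<lambda>u. g (fst p) u - g (snd p) u) U} = Sigma X N"
    by (auto simp: N_def)
  then have "real (card (Sigma X N)) \<le> \<eta> ^ 4 * n ^ 2" using few by (simp add: n_def)
  then have sumN: "(\<Sum>x\<in>X. real (card (N x))) \<le> \<eta> ^ 4 * n ^ 2"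
    using X fN by (subst (asm) card_SigmaI) auto
  have "real (card (X - G)) * (\<eta>\<^sup>2 * n) = (\<Sum>x\<in>X - G. \<eta>\<^sup>2 * n)" by simp
  also have "\<dots> \<le> (\<Sum>x\<in>X - G. real (card (N x)))"
    by (intro sum_mono) (auto simp: G_def)
  also have "\<dots> \<le> (\<Sum>x\<in>X. real (card (N x)))" using X by (intro sum_mono2) auto
  also have "\<dots> \<le> (\<eta>\<^sup>2 * n) * (\<eta>\<^sup>2 * n)" using sumN by (simp add: power2_eq_square power4_eq_xxxx mult_ac)
  finally have bad: "real (card (X - G)) \<le> \<eta>\<^sup>2 * n" using n \<eta> by simp
  \<comment> \<open>The least integer above \<open>\<eta> * n\<close>: large enough to keep
    \<open>Y\<close> small, while \<open>card W < s\<close> still gives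
    \<open>card W \<le> \<eta> * n\<close>.\<close>
  define s where "s = Suc (nat \<lfloor>\<eta> * n\<rfloor>)"
  have en: "\<eta> * n > 0" using n \<eta> by simp
  have s: "s > 0" "\<eta> * n \<le> real s" using en by (auto simp: s_def) linarith
  obtain Y where Y: "Y \<subseteq> G" "s * card Y \<le> card G"
    "\<And>W. W \<subseteq> G \<Longrightarrow> card W \<ge> s \<Longrightarrow> \<exists>y\<in>Y. \<exists>w\<in>W. \<exists>w'\<in>W. g w u0 \<le> g y u0 \<and> g y u0 \<le> g w' u0"
    using quantile_subset[OF fG(1) s(1), of "\<lambda>x. g x u0"] by auto
  have fY: "finite Y" using Y(1) fG finite_subset by blast
  have "(\<eta> * n) * real (card Y) \<le> real s * real (card Y)" using s by (intro mult_right_mono) auto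
  also have "\<dots> \<le> real (card G)" using Y(2) by (metis of_nat_le_iff of_nat_mult)
  also have "\<dots> \<le> n" using fG X by (simp add: n_def card_mono)
  finally have cY: "\<eta> * real (card Y) \<le> 1" using n by (simp add: mult_ac)
  have "real (card {x\<in>X. crosses (\<lambda>u. t u - g x u) V}) \<le> 3 * \<eta> * n"
    if V: "V = {u\<in>U. A = {y\<in>Y. g y u < t u} \<and> B = {y\<in>Y. t u < g y u}}" for A B V
  proof -
    \<comment> \<open>The crossed indices that neither lie outside \<open>G\<close> nor form a bad
      pair with a quantile. Among \<open>s\<close> of them, two would enclose a quantile
      \<open>y\<close> at \<open>u0\<close>, hence at every point of \<open>V\<close>.\<close>
    define W where "W = {x\<in>G. crosses (\<lambda>u. t u - g x u) V \<and> (\<forall>y\<in>Y. \<not> crosses (\<lambda>u. g y u - g x u) U)}"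
    have WG: "W \<subseteq> G" by (auto simp: W_def)
    have "card W < s"
    proof (rule ccontr)
      assume "\<not> card W < s"
      then obtain y w w' where h: "y \<in> Y" "w \<in> W" "w' \<in> W" "g w u0 \<le> g y u0" "g y u0 \<le> g w' u0"
        using Y(3)[OF WG] by auto
      have nc: "\<not> crosses (\<lambda>u. g y u - g w u) U" "\<not> crosses (\<lambda>u. g y u - g w' u) U"
        using h by (auto simp: W_def)
      have nc': "\<not> crosses (\<lambda>u. g w u - g y u) U"
        using nc(1) crosses_mult_left[of "-1" "\<lambda>u. g w u - g y u" U] by simp
      have le: "g w u \<le> g y u" "g y u \<le> g w' u" if "u \<in> V" for u
        using that V not_crosses_le[OF nc' u0 _ h(4)] not_crosses_le[OF nc(2) u0 _ h(5)] by auto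
      have cr: "crosses (\<lambda>u. t u - g w u) V" "crosses (\<lambda>u. t u - g w' u) V"
        using h by (auto simp: W_def)
      \<comment> \<open>On \<open>V\<close> the sign of \<open>t u - g y u\<close> is determined by
        these cases. If it is positive, \<open>w\<close> is not crossed; if negative,
        \<open>w'\<close> is not; if it is zero, a crossing of \<open>w\<close> would make
        \<open>y\<close> and \<open>w\<close> a bad pair.\<close>
      consider "y \<in> A" | "y \<in> B" | "y \<notin> A" "y \<notin> B" by blast
      then show False
      proof cases
        case 1
        then have "g w u < t u" if "u \<in> V" for u using le(1)[OF that] that V by auto
        then show False using cr(1) by (auto simp: crosses_def)
      next
        case 2
        then have "t u < g w' u" if "u \<in> V" for u using le(2)[OF that] that V by auto
        then show False using cr(2) by (auto simp: crosses_def)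
      next
        case 3
        then have "t u = g y u" if "u \<in> V" for u using that V h(1) by force
        then have "crosses (\<lambda>u. g y u - g w u) V" using cr(1) by (auto simp: crosses_def)
        then show False using nc(1) crosses_mono V by blast
      qed
    qed
    then have "card W \<le> nat \<lfloor>\<eta> * n\<rfloor>" by (simp add: s_def)
    then have cW: "real (card W) \<le> \<eta> * n" using en by linarith
    have "real (card (\<Union>y\<in>Y. N y)) \<le> real (\<Sum>y\<in>Y. card (N y))"
      using card_UN_le[OF fY, of N] by (simp only: of_nat_le_iff)
    also have "\<dots> \<le> (\<Sum>y\<in>Y. \<eta>\<^sup>2 * n)"
      unfolding of_nat_sum using Y(1) by (intro sum_mono) (auto simp: G_def)
    also have "\<dots> = (\<eta> * real (card Y)) * (\<eta> * n)" by (simp add: power2_eq_square)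
    also have "\<dots> \<le> 1 * (\<eta> * n)" using cY en by (intro mult_right_mono) auto
    finally have cU: "real (card (\<Union>y\<in>Y. N y)) \<le> \<eta> * n" by simp
    have "{x\<in>X. crosses (\<lambda>u. t u - g x u) V} \<subseteq> (X - G) \<union> ((\<Union>y\<in>Y. N y) \<union> W)"
      by (auto simp: W_def N_def)
    then have "card {x\<in>X. crosses (\<lambda>u. t u - g x u) V} \<le> card ((X - G) \<union> ((\<Union>y\<in>Y. N y) \<union> W))"
      using X fY fN WG fG by (intro card_mono) (auto intro: finite_subset)
    also have "\<dots> \<le> card (X - G) + (card (\<Union>y\<in>Y. N y) + card W)"
      by (meson add_left_mono card_Un_le le_trans)
    finally have "real (card {x\<in>X. crosses (\<lambda>u. t u - g x u) V})
        \<le> real (card (X - G)) + (real (card (\<Union>y\<in>Y. N y)) + real (card W))" by linarith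
    also have "\<dots> \<le> \<eta>\<^sup>2 * n + (\<eta> * n + \<eta> * n)" using bad cU cW by linarith
    also have "\<eta>\<^sup>2 * n \<le> \<eta> * n" using \<eta> n by (simp add: power2_eq_square mult_left_le)
    finally show ?thesis by simp
  qed
  moreover have "real (card Y) \<le> 1 / \<eta>" using cY \<eta> by (simp add: field_simps)
  ultimately show ?thesis using Y(1) fG(2) unfolding n_def by (intro exI[of _ Y]) auto
qed

text \<open>The cells may overlap and have any shape: only their number and their crossings are
  controlled.\<close>

definition cutting :: "'i set \<Rightarrow> ('i \<Rightarrow> 'u \<Rightarrow> real) \<Rightarrow> real \<Rightarrow> 'u set set \<Rightarrow> bool" where
  "cutting X f \<epsilon> \<C> \<longleftrightarrow> \<Union>\<C> = UNIV \<and> (\<forall>U\<in>\<C>. real (card {x\<in>X. crosses (f x) U}) \<le> \<epsilon> * real (card X))"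

text \<open>The induction solves for the new coordinate: each functional becomes a threshold \<open>g x\<close> on it, and
  the induction hypothesis is applied to the differences \<open>g x - g y\<close>. The indices are natural
  numbers so that pairs of indices are again indices.\<close>
lemma bounded_cutting:
  fixes K :: "'k set"
  assumes "finite K" "\<epsilon> > 0"
  shows "\<exists>M::nat. \<forall>(X::nat set) (c::nat \<Rightarrow> 'k \<Rightarrow> real). finite X \<longrightarrow>
    (\<exists>\<C>. finite \<C> \<and> card \<C> \<le> M \<and> cutting X (\<lambda>x (u::'k \<Rightarrow> real). \<Sum>k\<in>K. c x k * u k) \<epsilon> \<C>)"
  using assms
proof (induction K arbitrary: \<epsilon> rule: finite_induct)
  case empty
  have "cutting X (\<lambda>x (u::'k \<Rightarrow> real). \<Sum>k\<in>{}. c x k * u k) \<epsilon> {UNIV}" for X :: "nat set" and c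
    using empty by (simp add: cutting_def crosses_def)
  then show ?case by (intro exI[of _ 1] allI impI exI[of _ "{UNIV}"]) auto
next
  case (insert k K)
  \<comment> \<open>\<open>threshold_subdivision\<close> turns a fraction \<open>\<eta> ^ 4\<close>
    of crossed pairs into a fraction \<open>3 * \<eta>\<close> of crossed indices, whence the
    division by 3.\<close>
  define \<eta> where "\<eta> = min 1 (\<epsilon> / 3)"
  have \<eta>: "0 < \<eta>" "\<eta> \<le> 1" "3 * \<eta> \<le> \<epsilon>" using insert.prems by (auto simp: \<eta>_def)
  obtain M1 where M1: "\<And>(X::nat set) c. finite X \<Longrightarrow> \<exists>\<C>. finite \<C> \<and> card \<C> \<le> M1 \<and>
      cutting X (\<lambda>x (u::'k \<Rightarrow> real). \<Sum>k\<in>K. c x k * u k) (\<eta> ^ 4) \<C>"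
    using insert.IH[of "\<eta> ^ 4"] \<eta> by auto
  \<comment> \<open>A second cutting serves the functionals with coefficient 0 at \<open>k\<close>,
    which cannot be solved for \<open>u k\<close>.\<close>
  obtain M2 where M2: "\<And>(X::nat set) c. finite X \<Longrightarrow> \<exists>\<C>. finite \<C> \<and> card \<C> \<le> M2 \<and>
      cutting X (\<lambda>x (u::'k \<Rightarrow> real). \<Sum>k\<in>K. c x k * u k) \<epsilon> \<C>"
    using insert.IH[of \<epsilon>] insert.prems by auto
  define m where "m = nat \<lfloor>1 / \<eta>\<rfloor>"
  have "\<exists>\<C>. finite \<C> \<and> card \<C> \<le> M1 * (M2 * (2 ^ m * 2 ^ m)) \<and>
      cutting X (\<lambda>x (u::'k \<Rightarrow> real). \<Sum>j\<in>insert k K. c x j * u j) \<epsilon> \<C>"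
    if X: "finite X" for X :: "nat set" and c
  proof -
    define X0 where "X0 = {x\<in>X. c x k = 0}"
    define X1 where "X1 = {x\<in>X. c x k \<noteq> 0}"
    have fX: "finite X0" "finite X1" using X by (auto simp: X0_def X1_def)
    have cX: "card X = card X0 + card X1"
      using fX by (subst card_Un_disjoint[symmetric]) (auto simp: X0_def X1_def intro: arg_cong[where f=card])
    \<comment> \<open>The functional of \<open>x\<close> vanishes exactly when
      \<open>u k = g x u\<close>, as \<open>eq1\<close> below makes explicit.\<close>
    define g where "g x u = - (\<Sum>j\<in>K. c x j / c x k * u j)" for x and u :: "'k \<Rightarrow> real"
    \<comment> \<open>Coefficients of \<open>g x - g y\<close>, where \<open>z\<close> encodes the
      pair \<open>(x, y)\<close>: crossed indices in \<open>Z\<close> correspond to crossed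
      pairs.\<close>
    define b where "b z j = (case prod_decode z of (x, y) \<Rightarrow> c y j / c y k - c x j / c x k)" for z j
    define Z where "Z = prod_encode ` (X1 \<times> X1)"
    have fZ: "finite Z" using fX by (simp add: Z_def)
    have inj: "inj_on prod_encode S" for S :: "(nat \<times> nat) set"
      using inj_prod_encode by (rule inj_on_subset) auto
    have cZ: "card Z = card X1 * card X1"
      unfolding Z_def by (simp add: card_image[OF inj] card_cartesian_product)
    have b: "(\<Sum>j\<in>K. b (prod_encode p) j * u j) = g (fst p) u - g (snd p) u" for p u
      by (simp add: b_def g_def case_prod_beta left_diff_distrib sum_subtractf)
    obtain \<C>1 where C1: "finite \<C>1" "card \<C>1 \<le> M1" "\<Union>\<C>1 = UNIV"
      and "\<forall>U\<in>\<C>1. real (card {z\<in>Z. crosses (\<lambda>u. \<Sum>j\<in>K. b z j * u j) U}) \<le> \<eta> ^ 4 * real (card Z)"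
      using M1[OF fZ, of b] unfolding cutting_def by auto
    moreover have "{z\<in>Z. crosses (\<lambda>u. \<Sum>j\<in>K. b z j * u j) U} =
      prod_encode ` {p \<in> X1 \<times> X1. crosses (\<lambda>u. g (fst p) u - g (snd p) u) U}" for U
      unfolding Z_def b[symmetric] by auto
    ultimately have C1b: "\<forall>U\<in>\<C>1. real (card {p \<in> X1 \<times> X1. crosses (\<lambda>u. g (fst p) u - g (snd p) u) U})
        \<le> \<eta> ^ 4 * real (card X1) ^ 2"
      by (simp add: card_image[OF inj] cZ power2_eq_square)
    obtain \<C>2 where C2: "finite \<C>2" "card \<C>2 \<le> M2" "\<Union>\<C>2 = UNIV"
      "\<forall>U\<in>\<C>2. real (card {x\<in>X0. crosses (\<lambda>u. \<Sum>j\<in>K. c x j * u j) U}) \<le> \<epsilon> * real (card X0)"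
      using M2[OF fX(1), of c] unfolding cutting_def by auto
    define cell where "cell U Y p = {u\<in>U. fst p = {y\<in>Y. g y u < u k} \<and> snd p = {y\<in>Y. u k < g y u}}"
      for U Y and p :: "nat set \<times> nat set"
    have "\<forall>U\<in>\<C>1. \<exists>Y. Y \<subseteq> X1 \<and> real (card Y) \<le> 1 / \<eta> \<and>
        (\<forall>A B. real (card {x\<in>X1. crosses (\<lambda>u. u k - g x u) (cell U Y (A, B))}) \<le> 3 * \<eta> * real (card X1))"
    proof
      fix U assume "U \<in> \<C>1"
      from threshold_subdivision[OF fX(2) \<eta>(1,2) C1b[rule_format, OF this], of "\<lambda>u. u k"]
      show "\<exists>Y. Y \<subseteq> X1 \<and> real (card Y) \<le> 1 / \<eta> \<and>
        (\<forall>A B. real (card {x\<in>X1. crosses (\<lambda>u. u k - g x u) (cell U Y (A, B))}) \<le> 3 * \<eta> * real (card X1))"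
        unfolding cell_def fst_conv snd_conv .
    qed
    from bchoice[OF this] obtain Y where Y0: "\<forall>U\<in>\<C>1. Y U \<subseteq> X1 \<and> real (card (Y U)) \<le> 1 / \<eta> \<and>
        (\<forall>A B. real (card {x\<in>X1. crosses (\<lambda>u. u k - g x u) (cell U (Y U) (A, B))}) \<le> 3 * \<eta> * real (card X1))"
      by (elim exE)
    have Y: "Y U \<subseteq> X1" "real (card (Y U)) \<le> 1 / \<eta>"
      "real (card {x\<in>X1. crosses (\<lambda>u. u k - g x u) (cell U (Y U) p)}) \<le> 3 * \<eta> * real (card X1)"
      if "U \<in> \<C>1" for U p
      using bspec[OF Y0 that] by (cases p; simp)+
    have fY: "finite (Y U)" if "U \<in> \<C>1" for U using Y(1)[OF that] fX finite_subset by blast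
    have cY: "card (Y U) \<le> m" if "U \<in> \<C>1" for U using Y(2)[OF that] unfolding m_def by linarith
    define Q where "Q U = Pow (Y U) \<times> Pow (Y U)" for U
    have fQ: "finite (Q U)" if "U \<in> \<C>1" for U using fY[OF that] by (simp add: Q_def)
    have cQ: "card (Q U) \<le> 2 ^ m * 2 ^ m" if "U \<in> \<C>1" for U
      unfolding Q_def using fY[OF that] cY[OF that]
      by (simp add: card_cartesian_product card_Pow mult_mono)
    \<comment> \<open>A final cell is a cell of \<open>\<C>1\<close>, refined by the position of
      \<open>u k\<close> relative to its own thresholds \<open>Y U\<close>, and intersected with a
      cell of \<open>\<C>2\<close>.\<close>
    define I where "I = Sigma \<C>1 (\<lambda>U. \<C>2 \<times> Q U)"
    have fI: "finite I" using C1 C2 fQ by (simp add: I_def)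
    have "card I = (\<Sum>U\<in>\<C>1. card (\<C>2 \<times> Q U))"
      unfolding I_def using C1 C2 fQ by (subst card_SigmaI) auto
    also have "\<dots> \<le> (\<Sum>U\<in>\<C>1. M2 * (2 ^ m * 2 ^ m))"
      using C2(2) cQ by (intro sum_mono) (simp add: card_cartesian_product mult_mono)
    also have "\<dots> \<le> M1 * (M2 * (2 ^ m * 2 ^ m))" using C1(2) by simp
    finally have cI: "card I \<le> M1 * (M2 * (2 ^ m * 2 ^ m))" .
    define h where "h = (\<lambda>(U, V, p). V \<inter> cell U (Y U) p)"
    have "\<exists>i\<in>I. u \<in> h i" for u
    proof -
      have "u \<in> \<Union>\<C>1" "u \<in> \<Union>\<C>2" using C1(3) C2(3) by simp_all
      then obtain U V where UV: "U \<in> \<C>1" "u \<in> U" "V \<in> \<C>2" "u \<in> V" by (elim UnionE)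
      have "(U, V, {y\<in>Y U. g y u < u k}, {y\<in>Y U. u k < g y u}) \<in> I" using UV by (auto simp: I_def Q_def)
      moreover have "u \<in> h (U, V, {y\<in>Y U. g y u < u k}, {y\<in>Y U. u k < g y u})"
        using UV by (simp add: h_def cell_def)
      ultimately show ?thesis by (rule bexI[rotated])
    qed
    then have cover: "\<Union>(h ` I) = UNIV" by auto
    have small: "real (card {x\<in>X. crosses (\<lambda>u. \<Sum>j\<in>insert k K. c x j * u j) (h i)}) \<le> \<epsilon> * real (card X)"
      if "i \<in> I" for i
    proof -
      obtain U V p where i: "i = (U, V, p)" by (metis surj_pair)
      have UV: "U \<in> \<C>1" "V \<in> \<C>2" using that by (auto simp: i I_def)
      have hs: "h i \<subseteq> V" "h i \<subseteq> cell U (Y U) p" by (auto simp: i h_def)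
      have eq0: "(\<Sum>j\<in>insert k K. c x j * u j) = (\<Sum>j\<in>K. c x j * u j)" if "x \<in> X0" for x and u :: "'k \<Rightarrow> real"
        using that insert.hyps by (simp add: X0_def)
      have eq1: "(\<Sum>j\<in>insert k K. c x j * u j) = c x k * (u k - g x u)" if "x \<in> X1" for x u
        using that insert.hyps by (simp add: X1_def g_def distrib_left sum_distrib_left)
      have cr: "{x\<in>X. crosses (\<lambda>u. \<Sum>j\<in>insert k K. c x j * u j) (h i)} \<subseteq>
          {x\<in>X0. crosses (\<lambda>u. \<Sum>j\<in>K. c x j * u j) V} \<union>
          {x\<in>X1. crosses (\<lambda>u. u k - g x u) (cell U (Y U) p)}" (is "?L \<subseteq> ?A \<union> ?B")
      proof
        fix x assume x: "x \<in> ?L"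
        show "x \<in> ?A \<union> ?B"
        proof (cases "c x k = 0")
          case True
          then have "x \<in> X0" using x by (simp add: X0_def)
          then show ?thesis using x eq0[of x] crosses_mono[OF _ hs(1)] by auto
        next
          case False
          then have "x \<in> X1" using x by (simp add: X1_def)
          then show ?thesis
            using x eq1[of x] crosses_mono[OF _ hs(2)] crosses_mult_left[OF False] by auto
        qed
      qed
      have "card ?L \<le> card (?A \<union> ?B)" using fX by (intro card_mono[OF _ cr]) auto
      also have "\<dots> \<le> card ?A + card ?B" by (rule card_Un_le)
      finally have "real (card ?L) \<le> real (card ?A) + real (card ?B)" by linarith
      also have "\<dots> \<le> \<epsilon> * real (card X0) + 3 * \<eta> * real (card X1)"
        using C2(4) UV(2) Y(3)[OF UV(1), of p] by (intro add_mono) auto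
      also have "\<dots> \<le> \<epsilon> * real (card X0) + \<epsilon> * real (card X1)"
        using \<eta>(3) by (intro add_left_mono mult_right_mono) auto
      finally show ?thesis by (simp add: cX distrib_left)
    qed
    have "card (h ` I) \<le> M1 * (M2 * (2 ^ m * 2 ^ m))" using card_image_le[OF fI, of h] cI by linarith
    then show ?thesis using fI cover small unfolding cutting_def
      by (intro exI[of _ "h ` I"]) auto
  qed
  then show ?case by blast
qed

section \<open>Centerpoints\<close>

text \<open>The complements of at most \<open>DIM('b) + 1\<close> such sets are too small to cover
  \<open>P\<close>, so these sets share an index \<open>p\<close> and their hulls share
  \<open>x p\<close>. Helly's theorem then yields \<open>a\<close>.\<close>

lemma centerpoint:
  fixes x :: "'i \<Rightarrow> 'b::euclidean_space"
  assumes "finite P"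
  shows "\<exists>a. \<forall>S\<subseteq>P. DIM('b) * card P < (DIM('b) + 1) * card S \<longrightarrow> a \<in> convex hull (x ` S)"
proof -
  define \<S> where "\<S> = {S. S \<subseteq> P \<and> DIM('b) * card P < (DIM('b) + 1) * card S}"
  have fS: "finite \<S>" using assms by (auto simp: \<S>_def)
  define \<F> where "\<F> = (\<lambda>S. convex hull (x ` S)) ` \<S>"
  have fF: "finite \<F>" using fS by (simp add: \<F>_def)
  have small: "\<Inter>\<T> \<noteq> {}" if T: "\<T> \<subseteq> \<F>" "card \<T> \<le> DIM('b) + 1" for \<T>
  proof (cases "\<T> = {}")
    case True
    then show ?thesis by simp
  next
    case False
    have "\<forall>T\<in>\<T>. \<exists>S\<in>\<S>. T = convex hull (x ` S)" using T by (auto simp: \<F>_def)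
    then obtain s where s: "\<And>T. T \<in> \<T> \<Longrightarrow> s T \<in> \<S>" "\<And>T. T \<in> \<T> \<Longrightarrow> T = convex hull (x ` s T)" by metis
    have fT: "finite \<T>" using T(1) fF finite_subset by blast
    have "\<Inter>(s ` \<T>) \<noteq> {}"
    proof
      assume e: "\<Inter>(s ` \<T>) = {}"
      have "P \<subseteq> (\<Union>T\<in>\<T>. P - s T)" using e by blast
      then have "card P \<le> card (\<Union>T\<in>\<T>. P - s T)" using assms fT by (intro card_mono) auto
      also have "\<dots> \<le> (\<Sum>T\<in>\<T>. card (P - s T))" by (rule card_UN_le[OF fT])
      finally have 1: "(DIM('b) + 1) * card P \<le> (\<Sum>T\<in>\<T>. (DIM('b) + 1) * card (P - s T))"
        unfolding sum_distrib_left[symmetric] by (rule mult_le_mono2)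
      have lt: "(DIM('b) + 1) * card (P - s T) < card P" if "T \<in> \<T>" for T
      proof -
        have m: "s T \<subseteq> P" "DIM('b) * card P < (DIM('b) + 1) * card (s T)" using s(1)[OF that] by (auto simp: \<S>_def)
        then have "card P = card (P - s T) + card (s T)"
          using assms by (metis card_Diff_subset card_mono finite_subset le_add_diff_inverse2)
        then have "(DIM('b) + 1) * card P = (DIM('b) + 1) * card (P - s T) + (DIM('b) + 1) * card (s T)"
          by (metis distrib_left)
        then show ?thesis using m(2) by simp
      qed
      have "(\<Sum>T\<in>\<T>. (DIM('b) + 1) * card (P - s T)) < (\<Sum>T\<in>\<T>. card P)"
        by (rule sum_strict_mono[OF fT False lt])
      also have "\<dots> \<le> (DIM('b) + 1) * card P" using T(2) by (simp only: sum_constant of_nat_id mult_le_mono1)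
      finally show False using 1 by linarith
    qed
    then obtain p where "\<forall>T\<in>\<T>. p \<in> s T" by auto
    then have "x p \<in> T" if "T \<in> \<T>" for T using s(2)[OF that] that by (metis hull_inc image_eqI)
    then show ?thesis by blast
  qed
  \<comment> \<open>Helly's theorem requires at least \<open>DIM('b) + 1\<close> sets; a smaller
    family falls under \<open>small\<close> itself.\<close>
  have "\<Inter>\<F> \<noteq> {}"
  proof (cases "DIM('b) + 1 \<le> card \<F>")
    case True
    show ?thesis by (rule Helly[OF True]) (use small in \<open>auto simp: \<F>_def\<close>)
  next
    case False
    then show ?thesis by (intro small) auto
  qed
  then obtain a where "\<forall>S\<in>\<S>. a \<in> convex hull (x ` S)" by (auto simp: \<F>_def)
  then show ?thesis by (auto simp: \<S>_def)
qed

section \<open>Counting in projective planes\<close>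

context
  fixes P :: "'a set" and L :: "'a set set" and q :: nat
  assumes plane: "projective_plane P L q"
begin

lemma plane_facts:
  shows finite_points: "finite P" and finite_lines: "finite L"
    and line_subset: "l \<in> L \<Longrightarrow> l \<subseteq> P" and card_line: "l \<in> L \<Longrightarrow> card l = q + 1"
    and finite_line: "l \<in> L \<Longrightarrow> finite l"
    and joining_line: "x \<in> P \<Longrightarrow> y \<in> P \<Longrightarrow> x \<noteq> y \<Longrightarrow> \<exists>!l. l \<in> L \<and> x \<in> l \<and> y \<in> l"
    and meeting_point: "l \<in> L \<Longrightarrow> m \<in> L \<Longrightarrow> l \<noteq> m \<Longrightarrow> \<exists>!x. x \<in> l \<and> x \<in> m"
    and quadrangle: "\<exists>S\<subseteq>P. card S = 4 \<and> (\<forall>l\<in>L. card (S \<inter> l) \<le> 2)"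
proof -
  show f: "finite P" and s: "\<And>l. l \<in> L \<Longrightarrow> l \<subseteq> P"
    and "l \<in> L \<Longrightarrow> card l = q + 1"
    and "x \<in> P \<Longrightarrow> y \<in> P \<Longrightarrow> x \<noteq> y \<Longrightarrow> \<exists>!l. l \<in> L \<and> x \<in> l \<and> y \<in> l"
    and "l \<in> L \<Longrightarrow> m \<in> L \<Longrightarrow> l \<noteq> m \<Longrightarrow> \<exists>!x. x \<in> l \<and> x \<in> m"
    and "\<exists>S\<subseteq>P. card S = 4 \<and> (\<forall>l\<in>L. card (S \<inter> l) \<le> 2)"
    using plane unfolding projective_plane_def by (simp_all)
  have "L \<subseteq> Pow P" using s by auto
  then show "finite L" using f finite_subset by blast
  show "l \<in> L \<Longrightarrow> finite l" using f s finite_subset by blast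
qed

text \<open>At least three points of the quadrangle differ from \<open>p\<close>. The lines joining
  one of them to two others are distinct and meet only there, so they cannot both contain
  \<open>p\<close>.\<close>

lemma exists_line_avoiding:
  obtains l where "l \<in> L" "p \<notin> l"
proof -
  obtain S where S: "S \<subseteq> P" "card S = 4" "\<forall>l\<in>L. card (S \<inter> l) \<le> 2"
    using quadrangle by blast
  have "card (S - {p}) \<ge> 3" using S(2) by (cases "p \<in> S") (auto simp: card_Diff_singleton)
  then obtain T where "T \<subseteq> S - {p}" "card T = 3" by (metis obtain_subset_with_card_n)
  then obtain a b c where abc: "a \<noteq> b" "b \<noteq> c" "a \<noteq> c" "{a, b, c} \<subseteq> S - {p}"
    by (metis card_3_iff)
  have in_P: "a \<in> P" "b \<in> P" "c \<in> P" using abc S by auto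
  obtain l where l: "l \<in> L" "a \<in> l" "b \<in> l" using joining_line[of a b] abc in_P by blast
  obtain m where m: "m \<in> L" "a \<in> m" "c \<in> m" using joining_line[of a c] abc in_P by blast
  have "l \<noteq> m"
  proof
    assume "l = m"
    then have "{a, b, c} \<subseteq> S \<inter> l" using abc l m by auto
    moreover have "finite (S \<inter> l)" using finite_line[OF l(1)] by simp
    ultimately have "card {a, b, c} \<le> card (S \<inter> l)" by (intro card_mono)
    then show False using S(3) l(1) abc by fastforce
  qed
  have "p \<noteq> a" using abc by auto
  then have "p \<notin> l \<or> p \<notin> m" using meeting_point[OF l(1) m(1) \<open>l \<noteq> m\<close>] l m by blast
  then show thesis using that l m by blast
qed

text \<open>Projection from \<open>p\<close> onto a line \<open>m\<close> avoiding \<open>p\<close>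
  matches the lines through \<open>p\<close> with the points of \<open>m\<close>.\<close>

lemma card_lines_through:
  assumes p: "p \<in> P"
  shows "card {l\<in>L. p \<in> l} = q + 1"
proof -
  obtain m where m: "m \<in> L" "p \<notin> m" by (rule exists_line_avoiding)
  have "\<forall>y\<in>m. \<exists>l. l \<in> L \<and> p \<in> l \<and> y \<in> l"
    using joining_line[OF p] line_subset[OF m(1)] m(2) by (metis subsetD)
  then obtain f where f: "\<And>y. y \<in> m \<Longrightarrow> f y \<in> L \<and> p \<in> f y \<and> y \<in> f y" by metis
  have "bij_betw f m {l\<in>L. p \<in> l}"
    unfolding bij_betw_def
  proof
    show "inj_on f m"
    proof (rule inj_onI)
      fix y z assume y: "y \<in> m" "z \<in> m" "f y = f z"
      have "f y \<noteq> m" using f[OF y(1)] m(2) by auto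
      then show "y = z" using meeting_point[of "f y" m] f[OF y(1)] f[OF y(2)] y m(1) by metis
    qed
    show "f ` m = {l\<in>L. p \<in> l}"
    proof (intro equalityI subsetI)
      fix l assume "l \<in> {l\<in>L. p \<in> l}"
      then have l: "l \<in> L" "p \<in> l" "l \<noteq> m" using m by auto
      then obtain y where y: "y \<in> l" "y \<in> m" using meeting_point[OF l(1) m(1)] by blast
      have "y \<in> P" "p \<noteq> y" using y m line_subset by auto
      then have "l = f y" using joining_line[OF p] f[OF y(2)] l y by metis
      then show "l \<in> f ` m" using y by blast
    qed (use f in auto)
  qed
  then show ?thesis using card_line[OF m(1)] bij_betw_same_card by fastforce
qed

lemma card_lines_through2:
  assumes "p \<in> P" "r \<in> P" "p \<noteq> r"
  shows "card {l\<in>L. p \<in> l \<and> r \<in> l} = 1"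
proof -
  obtain l where "l \<in> L \<and> p \<in> l \<and> r \<in> l" "\<And>m. m \<in> L \<and> p \<in> m \<and> r \<in> m \<Longrightarrow> m = l"
    using joining_line[OF assms] by blast
  then have "{l\<in>L. p \<in> l \<and> r \<in> l} = {l}" by blast
  then show ?thesis by simp
qed

section \<open>Moments of the intersection sizes of lines with a point set\<close>

lemma sum_card_Int:
  assumes Z: "Z \<subseteq> P"
  shows "(\<Sum>l\<in>L. card (l \<inter> Z)) = (q + 1) * card Z"
proof -
  have fZ: "finite Z" using Z finite_points finite_subset by blast
  have "(\<Sum>l\<in>L. card (l \<inter> Z)) = (\<Sum>l\<in>L. \<Sum>p\<in>Z. of_bool (p \<in> l))"
    using fZ by (intro sum.cong) (auto simp: Int_commute Int_def)
  also have "\<dots> = (\<Sum>p\<in>Z. \<Sum>l\<in>L. of_bool (p \<in> l))" by (rule sum.swap)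
  also have "\<dots> = (\<Sum>p\<in>Z. q + 1)"
    using Z card_lines_through finite_lines by (intro sum.cong) (auto simp: Int_def)
  finally show ?thesis by simp
qed

text \<open>Counts triples of a line and two points of \<open>Z\<close> on it: an ordered pair of
  distinct points lies on one line, a repeated point on \<open>q + 1\<close>.\<close>

lemma sum_card_Int_square:
  assumes Z: "Z \<subseteq> P"
  shows "(\<Sum>l\<in>L. (card (l \<inter> Z))\<^sup>2) = card Z * (q + card Z)"
proof -
  have fZ: "finite Z" using Z finite_points finite_subset by blast
  have "(\<Sum>l\<in>L. (card (l \<inter> Z))\<^sup>2) = (\<Sum>l\<in>L. \<Sum>p\<in>Z. \<Sum>r\<in>Z. of_bool (p \<in> l \<and> r \<in> l))"
  proof (intro sum.cong refl)
    fix l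
    have "card (l \<inter> Z) = (\<Sum>p\<in>Z. of_bool (p \<in> l))"
      using fZ by (auto simp: Int_commute Int_def)
    then have "(card (l \<inter> Z))\<^sup>2 = (\<Sum>p\<in>Z. \<Sum>r\<in>Z. of_bool (p \<in> l) * of_bool (r \<in> l))"
      by (simp only: power2_eq_square sum_product)
    then show "(card (l \<inter> Z))\<^sup>2 = (\<Sum>p\<in>Z. \<Sum>r\<in>Z. of_bool (p \<in> l \<and> r \<in> l))"
      by (simp only: of_bool_conj)
  qed
  also have "\<dots> = (\<Sum>p\<in>Z. \<Sum>l\<in>L. \<Sum>r\<in>Z. of_bool (p \<in> l \<and> r \<in> l))" by (rule sum.swap)
  also have "\<dots> = (\<Sum>p\<in>Z. \<Sum>r\<in>Z. \<Sum>l\<in>L. of_bool (p \<in> l \<and> r \<in> l))"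
    by (intro sum.cong refl sum.swap)
  also have "\<dots> = (\<Sum>p\<in>Z. \<Sum>r\<in>Z. card {l\<in>L. p \<in> l \<and> r \<in> l})"
    using finite_lines by (intro sum.cong) (auto simp: Int_def)
  also have "\<dots> = (\<Sum>p\<in>Z. q + card Z)"
  proof (intro sum.cong refl)
    fix p assume p: "p \<in> Z"
    have "(\<Sum>r\<in>Z. card {l\<in>L. p \<in> l \<and> r \<in> l}) =
        card {l\<in>L. p \<in> l \<and> p \<in> l} + (\<Sum>r\<in>Z - {p}. card {l\<in>L. p \<in> l \<and> r \<in> l})"
      by (rule sum.remove[OF fZ p])
    also have "\<dots> = (q + 1) + (\<Sum>r\<in>Z - {p}. 1)"
      using card_lines_through card_lines_through2 p Z
      by (intro arg_cong2[of _ _ _ _ "(+)"] sum.cong) (auto simp: subset_iff)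
    also have "\<dots> = q + card Z"
      using card_Suc_Diff1[OF fZ p] by simp
    finally show "(\<Sum>r\<in>Z. card {l\<in>L. p \<in> l \<and> r \<in> l}) = q + card Z" .
  qed
  finally show ?thesis by simp
qed

lemma points_nonempty: "P \<noteq> {}"
  using quadrangle by force

text \<open>The first moment for \<open>Z = P\<close>, to which every line contributes
  \<open>q + 1\<close>.\<close>

lemma card_lines_eq_card_points: "card L = card P"
proof -
  have "(\<Sum>l\<in>L. card (l \<inter> P)) = (\<Sum>l\<in>L. q + 1)"
    using line_subset card_line by (intro sum.cong) (auto simp: Int_absorb2)
  then have "(q + 1) * card L = (q + 1) * card P" using sum_card_Int[of P] by simp
  then show ?thesis by (metis add_is_0 mult_left_cancel zero_neq_one)
qed

text \<open>The second moment for \<open>Z = P\<close>, divided by \<open>card P\<close>.\<close>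

lemma card_points: "card P = q\<^sup>2 + q + 1"
proof -
  have "(\<Sum>l\<in>L. (card (l \<inter> P))\<^sup>2) = (\<Sum>l\<in>L. (q + 1)\<^sup>2)"
    using line_subset card_line by (intro sum.cong) (auto simp: Int_absorb2)
  then have "card P * (q + 1)\<^sup>2 = card P * (q + card P)"
    using sum_card_Int_square[of P] card_lines_eq_card_points by auto
  moreover have "card P > 0" using points_nonempty finite_points by (simp add: card_gt_0_iff)
  ultimately have "(q + 1)\<^sup>2 = q + card P" by (metis mult_left_cancel not_gr_zero)
  then show ?thesis by (simp add: power2_eq_square)
qed

text \<open>Chebyshev's inequality: over all lines the size of \<open>l \<inter> Z\<close> has mean
  \<open>(q + 1) * card Z / card P\<close> and small variance, and a line missing \<open>Z\<close>
  deviates by the whole mean.\<close>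

lemma card_lines_missing:
  assumes Z: "Z \<subseteq> P"
  shows "card {l\<in>L. l \<inter> Z = {}} * card Z \<le> q * card P"
proof (cases "card Z = 0")
  case False
  define n z r k where "n = real (card P)" and "z = real (card Z)" and "r = real q"
    and "k = real (card {l\<in>L. l \<inter> Z = {}})"
  define w where "w l = real (card (l \<inter> Z))" for l
  have nr: "n = r\<^sup>2 + r + 1" by (simp add: n_def r_def card_points)
  have pos: "z > 0" "r \<ge> 0" "n > 0" using False by (auto simp: z_def r_def nr add_nonneg_pos)
  have s1: "(\<Sum>l\<in>L. w l) = (r + 1) * z"
    using arg_cong[OF sum_card_Int[OF Z], of real] by (simp add: w_def z_def r_def algebra_simps)
  have s2: "(\<Sum>l\<in>L. (w l)\<^sup>2) = z * (r + z)"
    using arg_cong[OF sum_card_Int_square[OF Z], of real] by (simp add: w_def z_def r_def algebra_simps)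
  \<comment> \<open>Deviations from the mean are multiplied by \<open>n\<close>, the number of
    lines, to avoid fractions.\<close>
  have "k * ((r + 1) * z)\<^sup>2 = (\<Sum>l\<in>{l\<in>L. l \<inter> Z = {}}. (n * w l - (r + 1) * z)\<^sup>2)"
    by (simp add: k_def w_def)
  also have "\<dots> \<le> (\<Sum>l\<in>L. (n * w l - (r + 1) * z)\<^sup>2)"
    using finite_lines by (intro sum_mono2) auto
  also have "\<dots> = (\<Sum>l\<in>L. n\<^sup>2 * (w l)\<^sup>2 - 2 * n * (r + 1) * z * w l + ((r + 1) * z)\<^sup>2)"
    by (intro sum.cong) (auto simp: power2_eq_square algebra_simps)
  also have "\<dots> = n\<^sup>2 * (z * (r + z)) - 2 * n * (r + 1) * z * ((r + 1) * z) + n * ((r + 1) * z)\<^sup>2"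
    by (simp only: sum.distrib sum_subtractf sum_distrib_left[symmetric] s1 s2 sum_constant)
      (simp add: card_lines_eq_card_points n_def)
  \<comment> \<open>The terms collapse because \<open>(r + 1)\<^sup>2 = n + r\<close>.\<close>
  also have "\<dots> = n * (z * (r * (n - z)))" unfolding nr by algebra
  also have "\<dots> \<le> n * (z * (r * n))" using pos by (intro mult_left_mono) auto
  finally have "(k * z * (r + 1)\<^sup>2) * z \<le> (r * n * n) * z" by (simp add: power2_eq_square mult_ac)
  then have "k * z * (r + 1)\<^sup>2 \<le> r * n * n"
    by (rule mult_right_le_imp_le) (use pos in simp)
  also have "\<dots> \<le> r * n * (r + 1)\<^sup>2"
    using pos by (intro mult_left_mono) (auto simp: nr power2_eq_square algebra_simps)
  finally have "k * z \<le> r * n"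
    by (rule mult_right_le_imp_le) (use pos in simp)
  then show ?thesis unfolding k_def z_def r_def n_def by (simp only: of_nat_mult[symmetric] of_nat_le_iff)
qed simp

end

section \<open>Non-representability\<close>

text \<open>A weak form of Pach's selection theorem: every transversal of \<open>\<Z>\<close> has \<open>a\<close> in its convex
  hull, but the number of sets is only bounded in terms of the dimension.\<close>
lemma weak_point_selection:
  obtains M :: nat where "\<And>(P::nat set) (x::nat \<Rightarrow> 'b::euclidean_space). finite P \<Longrightarrow>
    \<exists>a \<Z>. finite \<Z> \<and> card \<Z> \<le> M \<and>
      (\<forall>Z\<in>\<Z>. Z \<subseteq> P \<and> card P \<le> 2 * (DIM('b) + 1) * card Z) \<and>
      (\<forall>S\<subseteq>P. a \<notin> convex hull (x ` S) \<longrightarrow> (\<exists>Z\<in>\<Z>. S \<inter> Z = {}))"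
proof -
  define d where "d = DIM('b)"
  \<comment> \<open>Half of the share \<open>1 / (d + 1)\<close> guaranteed by the centerpoint:
    crossed points use up at most this half, and the other half remains for
    \<open>Zc U\<close>.\<close>
  define \<epsilon> :: real where "\<epsilon> = 1 / (2 * (real d + 1))"
  have \<epsilon>: "\<epsilon> > 0" by (simp add: \<epsilon>_def add_nonneg_pos)
  obtain M where M: "\<And>(P::nat set) (c::nat \<Rightarrow> 'b \<Rightarrow> real). finite P \<Longrightarrow>
      \<exists>\<C>. finite \<C> \<and> card \<C> \<le> M \<and> cutting P (\<lambda>p (w::'b \<Rightarrow> real). \<Sum>k\<in>Basis. c p k * w k) \<epsilon> \<C>"
    using bounded_cutting[OF finite_Basis \<epsilon>] by blast
  show thesis
  proof (rule that[of M])
    fix P :: "nat set" and x :: "nat \<Rightarrow> 'b"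
    assume P: "finite P"
    obtain a where a: "\<And>S. S \<subseteq> P \<Longrightarrow> d * card P < (d + 1) * card S \<Longrightarrow> a \<in> convex hull (x ` S)"
      using centerpoint[OF P, of x] unfolding d_def by auto
    \<comment> \<open>The inner product of \<open>x p - a\<close> with the direction whose
      coordinates are \<open>w\<close>.\<close>
    define f where "f p w = (\<Sum>k\<in>Basis. ((x p - a) \<bullet> k) * w k)" for p and w :: "'b \<Rightarrow> real"
    obtain \<C> where C: "finite \<C>" "card \<C> \<le> M" "\<Union>\<C> = UNIV"
      "\<And>U. U \<in> \<C> \<Longrightarrow> real (card {p\<in>P. crosses (f p) U}) \<le> \<epsilon> * real (card P)"
      using M[OF P, of "\<lambda>p k. (x p - a) \<bullet> k"] unfolding cutting_def f_def by auto
    \<comment> \<open>Points on the nonpositive side for every direction in the cell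
      \<open>U\<close>, so one set serves all these directions.\<close>
    define Zc where "Zc U = {p\<in>P. \<forall>w\<in>U. f p w \<le> 0}" for U
    define \<Z> where "\<Z> = {Z \<in> Zc ` \<C>. card P \<le> 2 * (d + 1) * card Z}"
    have "finite \<Z>" using C(1) by (simp add: \<Z>_def)
    moreover have "card \<Z> \<le> M"
    proof -
      have "card \<Z> \<le> card (Zc ` \<C>)" using C(1) by (intro card_mono) (auto simp: \<Z>_def)
      then show ?thesis using card_image_le[OF C(1), of Zc] C(2) by linarith
    qed
    moreover have "\<forall>Z\<in>\<Z>. Z \<subseteq> P \<and> card P \<le> 2 * (d + 1) * card Z"
      by (auto simp: \<Z>_def Zc_def)
    moreover have "\<exists>Z\<in>\<Z>. S \<inter> Z = {}" if S: "S \<subseteq> P" "a \<notin> convex hull (x ` S)" for S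
    proof -
      have "finite (x ` S)" using S(1) P finite_subset by blast
      then have "closed (convex hull (x ` S))" by (intro compact_imp_closed finite_imp_compact_convex_hull)
      then obtain u b where ub: "u \<bullet> a < b" "\<And>y. y \<in> convex hull (x ` S) \<Longrightarrow> u \<bullet> y > b"
        using separating_hyperplane_closed_point[OF convex_convex_hull _ S(2)] by blast
      define w where "w k = u \<bullet> k" for k
      have fw: "f p w = u \<bullet> x p - u \<bullet> a" for p
        unfolding f_def w_def euclidean_inner[of "x p - a" u, symmetric]
        by (simp add: inner_diff_left inner_diff_right inner_commute)
      have posS: "f p w > 0" if "p \<in> S" for p
        using ub(1) ub(2)[of "x p"] that by (simp add: fw hull_inc)
      \<comment> \<open>The hull of \<open>T\<close> lies in an open half-space with
        \<open>a\<close> on its boundary, so \<open>T\<close> has at most the share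
        \<open>d / (d + 1)\<close> of the points.\<close>
      define T where "T = {p\<in>P. f p w > 0}"
      have "convex hull (x ` T) \<subseteq> {y. u \<bullet> y > u \<bullet> a}"
        by (rule hull_minimal) (auto simp: T_def fw convex_halfspace_gt)
      then have "a \<notin> convex hull (x ` T)" by blast
      moreover have "T \<subseteq> P" by (auto simp: T_def)
      ultimately have "(d + 1) * card T \<le> d * card P" using a[of T] by (meson not_le)
      then have cT: "real ((d + 1) * card T) \<le> real (d * card P)" by (simp only: of_nat_le_iff)
      have "w \<in> \<Union>\<C>" using C(3) by simp
      then obtain U where U: "U \<in> \<C>" "w \<in> U" by (elim UnionE)
      \<comment> \<open>A point outside \<open>T\<close> is nonpositive at \<open>w\<close>; unless
        it is crossed, it stays nonpositive on all of \<open>U\<close>.\<close>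
      have sub: "P \<subseteq> T \<union> ({p\<in>P. crosses (f p) U} \<union> Zc U)"
      proof
        fix p assume p: "p \<in> P"
        show "p \<in> T \<union> ({p\<in>P. crosses (f p) U} \<union> Zc U)"
        proof (cases "p \<in> T \<or> crosses (f p) U")
          case False
          then have "f p w \<le> 0" using p by (auto simp: T_def)
          then have "f p v \<le> 0" if "v \<in> U" for v
            using not_crosses_le[of "f p" "\<lambda>_. 0" U w v] False U that by simp
          then show ?thesis using p by (auto simp: Zc_def)
        qed (use p in auto)
      qed
      have "card P \<le> card (T \<union> ({p\<in>P. crosses (f p) U} \<union> Zc U))"
        using P by (intro card_mono[OF _ sub]) (auto simp: T_def Zc_def)
      also have "\<dots> \<le> card T + (card {p\<in>P. crosses (f p) U} + card (Zc U))"
        by (meson add_left_mono card_Un_le le_trans)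
      finally have "real (card P) \<le> real (card T) + \<epsilon> * real (card P) + real (card (Zc U))"
        using C(4)[OF U(1)] by linarith
      then have "2 * (real d + 1) * real (card P) \<le>
          2 * (real d + 1) * (real (card T) + \<epsilon> * real (card P) + real (card (Zc U)))"
        by (intro mult_left_mono) auto
      also have "\<dots> = 2 * real ((d + 1) * card T) + (2 * (real d + 1) * \<epsilon>) * real (card P) + real (2 * (d + 1) * card (Zc U))"
        by (simp add: algebra_simps)
      also have "2 * (real d + 1) * \<epsilon> = 1" by (simp add: \<epsilon>_def add_nonneg_eq_0_iff)
      finally have "real (card P) \<le> real (2 * (d + 1) * card (Zc U))" using cT by (simp add: algebra_simps)
      then have "Zc U \<in> \<Z>" using U(1) unfolding \<Z>_def of_nat_le_iff by blast
      moreover have "S \<inter> Zc U = {}" using posS U(2) by (force simp: Zc_def)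
      ultimately show ?thesis by blast
    qed
    ultimately show "\<exists>a \<Z>. finite \<Z> \<and> card \<Z> \<le> M \<and>
      (\<forall>Z\<in>\<Z>. Z \<subseteq> P \<and> card P \<le> 2 * (DIM('b) + 1) * card Z) \<and>
      (\<forall>S\<subseteq>P. a \<notin> convex hull (x ` S) \<longrightarrow> (\<exists>Z\<in>\<Z>. S \<inter> Z = {}))"
      unfolding d_def by (intro exI[of _ a] exI[of _ \<Z>]) simp
  qed
qed

lemma large_planes_not_representable:
  "\<exists>q0::nat. \<forall>(P::nat set) L q. projective_plane P L q \<and> q \<ge> q0 \<longrightarrow>
     \<not> representable_convex_in P L TYPE('b::euclidean_space)"
proof -
  obtain M where M: "\<And>(P::nat set) (x::nat \<Rightarrow> 'b). finite P \<Longrightarrow>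
    \<exists>a \<Z>. finite \<Z> \<and> card \<Z> \<le> M \<and>
      (\<forall>Z\<in>\<Z>. Z \<subseteq> P \<and> card P \<le> 2 * (DIM('b) + 1) * card Z) \<and>
      (\<forall>S\<subseteq>P. a \<notin> convex hull (x ` S) \<longrightarrow> (\<exists>Z\<in>\<Z>. S \<inter> Z = {}))"
    by (rule weak_point_selection[where 'b='b]) (erule that)
  define m where "m = 2 * (DIM('b) + 1)"
  \<comment> \<open>\<open>q \<ge> M * m + 1\<close> makes \<open>q * (M * m)\<close>, which bounds
    the number of lines outside \<open>G\<close>, smaller than \<open>q * q\<close>. Both
    \<open>M\<close> and \<open>m\<close> depend on the dimension alone.\<close>
  have "\<not> representable_convex_in P L TYPE('b)"
    if plane: "projective_plane P L q" and q: "q \<ge> M * m + 1" for P :: "nat set" and L q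
  proof
    assume "representable_convex_in P L TYPE('b)"
    then obtain C :: "nat set \<Rightarrow> 'b set" where "convex_representation P L C"
      unfolding representable_convex_in_def by (elim exE)
    then have C: "\<And>l. l \<in> L \<Longrightarrow> convex (C l)"
      "\<And>S. S \<subseteq> L \<Longrightarrow> S \<noteq> {} \<Longrightarrow> finite S \<Longrightarrow> (\<Inter>A\<in>S. C A) \<noteq> {} \<longleftrightarrow> (\<exists>x\<in>P. \<forall>A\<in>S. x \<in> A)"
      unfolding convex_representation_def by simp_all
    note fin = finite_points[OF plane] finite_lines[OF plane]
    have "\<exists>y. \<forall>l\<in>L. p \<in> l \<longrightarrow> y \<in> C l" if p: "p \<in> P" for p
    proof -
      let ?S = "{l\<in>L. p \<in> l}"
      have "?S \<noteq> {}" using card_lines_through[OF plane p] by force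
      moreover have "finite ?S" using fin by simp
      moreover have "\<exists>r\<in>P. \<forall>A\<in>?S. r \<in> A" using p by blast
      ultimately have "(\<Inter>A\<in>?S. C A) \<noteq> {}" using C(2)[of ?S] by (metis (no_types) Collect_subset)
      then show ?thesis unfolding ex_in_conv[symmetric] by fastforce
    qed
    then obtain x where x: "\<And>p l. p \<in> P \<Longrightarrow> l \<in> L \<Longrightarrow> p \<in> l \<Longrightarrow> x p \<in> C l" by metis
    obtain a \<Z> where aZ: "finite \<Z>" "card \<Z> \<le> M"
      "\<And>Z. Z \<in> \<Z> \<Longrightarrow> Z \<subseteq> P \<and> card P \<le> m * card Z"
      "\<And>S. S \<subseteq> P \<Longrightarrow> a \<notin> convex hull (x ` S) \<Longrightarrow> \<exists>Z\<in>\<Z>. S \<inter> Z = {}"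
      using M[OF fin(1), of x] unfolding m_def by metis
    define G where "G = {l\<in>L. a \<in> convex hull (x ` l)}"
    have fG: "finite G" "G \<subseteq> L" using fin by (auto simp: G_def)
    \<comment> \<open>\<open>card P \<le> m * card Z\<close> allows \<open>card Z\<close> to be
      cancelled in \<open>card_lines_missing\<close>.\<close>
    have miss: "card {l\<in>L. l \<inter> Z = {}} \<le> q * m" if "Z \<in> \<Z>" for Z
    proof -
      have Z: "Z \<subseteq> P" "card P \<le> m * card Z" using aZ(3)[OF that] by auto
      have "card P > 0" using card_points[OF plane] by simp
      then have pos: "card Z > 0" using Z(2) by (cases "card Z") auto
      have "card {l\<in>L. l \<inter> Z = {}} * card Z \<le> q * card P" by (rule card_lines_missing[OF plane Z(1)])
      also have "\<dots> \<le> q * m * card Z" using Z(2) by (simp add: mult.assoc)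
      finally show ?thesis using pos by (rule mult_right_le_imp_le)
    qed
    have "L - G \<subseteq> (\<Union>Z\<in>\<Z>. {l\<in>L. l \<inter> Z = {}})"
    proof
      fix l assume "l \<in> L - G"
      then have l: "l \<in> L" "a \<notin> convex hull (x ` l)" by (simp_all add: G_def)
      with aZ(4)[OF line_subset[OF plane l(1)]] show "l \<in> (\<Union>Z\<in>\<Z>. {l\<in>L. l \<inter> Z = {}})" by simp
    qed
    then have "card (L - G) \<le> card (\<Union>Z\<in>\<Z>. {l\<in>L. l \<inter> Z = {}})"
      using aZ(1) fin by (intro card_mono) auto
    also have "\<dots> \<le> (\<Sum>Z\<in>\<Z>. card {l\<in>L. l \<inter> Z = {}})" by (rule card_UN_le[OF aZ(1)])
    also have "\<dots> \<le> (\<Sum>Z\<in>\<Z>. q * m)" by (rule sum_mono[OF miss])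
    also have "\<dots> \<le> M * (q * m)" using aZ(2) by simp
    finally have bad: "card (L - G) \<le> q * (M * m)" by (simp add: mult_ac)
    have "q * (M * m) < q * q" using q by simp
    moreover have "card L = card G + card (L - G)"
      using fin fG by (simp add: card_Diff_subset card_mono)
    moreover have "card L = q * q + q + 1"
      using card_lines_eq_card_points[OF plane] card_points[OF plane] by (simp add: power2_eq_square)
    ultimately have big: "card G > q + 1" using bad by linarith
    have "a \<in> C l" if "l \<in> G" for l
    proof -
      have l: "l \<in> L" "a \<in> convex hull (x ` l)" using that by (auto simp: G_def)
      have "x ` l \<subseteq> C l" using x l(1) line_subset[OF plane l(1)] by auto
      then have "convex hull (x ` l) \<subseteq> C l" by (intro hull_minimal C(1) l(1))
      then show ?thesis using l(2) by auto
    qed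
    \<comment> \<open>The common point \<open>a\<close> transfers back through the representation to
      a point of the plane on all lines of \<open>G\<close>, which are too many to be
      concurrent.\<close>
    then have "(\<Inter>A\<in>G. C A) \<noteq> {}" by (metis INT_I empty_iff)
    moreover have "G \<noteq> {}" using big by auto
    ultimately obtain p where p: "p \<in> P" "\<forall>l\<in>G. p \<in> l" using C(2)[OF fG(2)] fG(1) by blast
    then have "G \<subseteq> {l\<in>L. p \<in> l}" using fG(2) by auto
    then have "card G \<le> q + 1" using card_lines_through[OF plane p(1)] fin card_mono[of "{l\<in>L. p \<in> l}" G] by simp
    then show False using big by simp
  qed
  then show ?thesis by (intro exI[of _ "M * m + 1"] allI impI) (elim conjE)
qed

theorem theorem1:
  shows "\<exists>q0::nat. \<forall>(P::nat set) (L::nat set set) (q::nat).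
           projective_plane P L q \<and> q \<ge> q0 \<longrightarrow>
           \<not> representable_convex_in P L TYPE(real ^ 'd)"
  by (rule large_planes_not_representable)

end
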